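(* Let $p,q\ge 1$ and let $\mathrm d\mu$ be a $q\times p$ matrix of measures on an interval $\Delta\subseteq\mathbb R$ with all moments finite. Suppose that the Gauss--Borel factorizations $\mathscr M_L^{(k)}=(\mathscr L_L^{(k)})^{-1}(\mathscr U_L^{(k)})^{-1}$ exist for $k=0,\ldots,p$ and $\mathscr M_R^{(k)}=(\mathscr L_R^{(k)})^{-1}(\mathscr U_R^{(k)})^{-1}$ exist for $k=0,\ldots,q$. Let $L_1,\ldots,L_p$ be the lower bidiagonal matrices with unit diagonal determined by $(\mathscr U_L^{(k-1)})^{-1}\Lambda^\top=L_k(\mathscr U_L^{(k)})^{-1}$, equivalently $\mathscr L_L^{(k)}=L_k^{-1}\mathscr L_L^{(k-1)}$, $1\le k\le p$, and let $U_1,\ldots,U_q$ be the upper bidiagonal matrices with unit superdiagonal determined by $\Lambda(\mathscr L_R^{(k-1)})^{-1}=(\mathscr L_R^{(k)})^{-1}U_k$, equivalently $\mathscr U_R^{(k)}=\mathscr U_R^{(k-1)}U_k^{-1}$, $1\le k\le q$. Then the banded recurrence matrix $T$ has the bidiagonal factorization $$T=L_1\cdots L_p\,U_q\cdots U_1 .$$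
   Context: All semi-infinite matrices have rows and columns indexed by $\mathbb N_0$; identities between them are understood entrywise (all sums involved are finite). $I_r$ is the $r\times r$ identity and $X_{[r]}(x)=\begin{bmatrix} I_r\\ xI_r\\ x^2I_r\\ \vdots\end{bmatrix}$. The moment matrix of a $q\times p$ matrix of measures $\mathrm d\mu$ is $\mathscr M(\mu)=\int_\Delta X_{[q]}(x)\,\mathrm d\mu(x)\,X_{[p]}^\top(x)$. $\Lambda$ is the shift matrix with $\Lambda_{n,n+1}=1$ and all other entries $0$. A Gauss--Borel factorization of a semi-infinite matrix $\mathscr M$ is $\mathscr M=\mathscr L^{-1}\mathscr U^{-1}$ with $\mathscr L$ lower unitriangular and $\mathscr U$ nonsingular upper triangular (it is unique when it exists). Christoffel perturbations: let $\mathfrak X_{[r]}(x)$ be the $r\times r$ matrix with entries $1$ on the first superdiagonal, entry $x$ in position $(r,1)$, and $0$ elsewhere (for $r=1$, $\mathfrak X_{[1]}(x)=x$), so $\mathfrak X_{[r]}^r=xI_r$. Put $\mathrm d\mu_L^{(k)}=\mathrm d\mu\,(\mathfrak X_{[p]}^k)^\top$ and $\mathrm d\mu_R^{(k)}=\mathfrak X_{[q]}^k\,\mathrm d\mu$. Their moment matrices are $\mathscr M_L^{(k)}=\mathscr M(\mu)(\Lambda^k)^\top$ and $\mathscr M_R^{(k)}=\Lambda^k\mathscr M(\mu)$. For $k=0$ both are $\mathscr M(\mu)$ and the corresponding factors are written $\mathscr L=\mathscr L_L^{(0)}=\mathscr L_R^{(0)}$, $\mathscr U=\mathscr U_L^{(0)}=\mathscr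 U_R^{(0)}$. The banded recurrence matrix is $T=\mathscr L\,\Lambda^q\,\mathscr L^{-1}=\mathscr U^{-1}(\Lambda^p)^\top\mathscr U$ (the two expressions agree because $\Lambda^q\mathscr M=\mathscr M(\Lambda^p)^\top$). *)

theory Defs
  imports
    "HOL-Analysis.Bochner_Integration"
    "HOL-Analysis.Borel_Space"
    "HOL-Analysis.Topology_Euclidean_Space"
    "HOL-Library.Groups_Big_Fun"
    "Jordan_Normal_Form.Matrix"
begin

section \<open>Semi-infinite matrices\<close>

type_synonym smat = "nat \<Rightarrow> nat \<Rightarrow> real"

text \<open>Each entry of a product is a sum over the support of its summands. It has the
  intended value when that support is finite, as it is in every product used here.\<close>

definition smult_mat :: "smat \<Rightarrow> smat \<Rightarrow> smat" (infixl "\<star>" 70) where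
  "A \<star> B = (\<lambda>i j. Sum_any (\<lambda>k. A i k * B k j))"

definition sid :: smat where
  "sid = (\<lambda>i j. if i = j then 1 else 0)"

primrec spow :: "smat \<Rightarrow> nat \<Rightarrow> smat" where
  "spow A 0 = sid"
| "spow A (Suc k) = A \<star> spow A k"

definition stranspose :: "smat \<Rightarrow> smat" where
  "stranspose A = (\<lambda>i j. A j i)"

definition sprod :: "smat list \<Rightarrow> smat" where
  "sprod As = foldr (\<star>) As sid"

definition is_sinverse :: "smat \<Rightarrow> smat \<Rightarrow> bool" where
  "is_sinverse A B \<longleftrightarrow> A \<star> B = sid \<and> B \<star> A = sid"

definition snonsingular :: "smat \<Rightarrow> bool" where
  "snonsingular A \<longleftrightarrow> (\<exists>B. is_sinverse A B)"

text \<open>Only used for triangular matrices with nonzero diagonal, whose two-sided inverse exists and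
  is unique (for general semi-infinite matrices it need not be unique).\<close>

definition sinverse :: "smat \<Rightarrow> smat" where
  "sinverse A = (THE B. is_sinverse A B)"

definition shift :: smat  ("\<Lambda>") where
  "\<Lambda> = (\<lambda>i j. if j = Suc i then 1 else 0)"

definition lower_unitriangular :: "smat \<Rightarrow> bool" where
  "lower_unitriangular A \<longleftrightarrow> (\<forall>i. A i i = 1) \<and> (\<forall>i j. i < j \<longrightarrow> A i j = 0)"

definition supper_triangular :: "smat \<Rightarrow> bool" where
  "supper_triangular A \<longleftrightarrow> (\<forall>i j. j < i \<longrightarrow> A i j = 0)"

definition unit_lower_bidiagonal :: "smat \<Rightarrow> bool" where
  "unit_lower_bidiagonal A \<longleftrightarrow>
     (\<forall>i. A i i = 1) \<and> (\<forall>i j. j \<noteq> i \<and> i \<noteq> Suc j \<longrightarrow> A i j = 0)"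

definition unit_upper_bidiagonal :: "smat \<Rightarrow> bool" where
  "unit_upper_bidiagonal A \<longleftrightarrow>
     (\<forall>i. A i (Suc i) = 1) \<and> (\<forall>i j. j \<noteq> i \<and> j \<noteq> Suc i \<longrightarrow> A i j = 0)"

definition gauss_borel :: "smat \<Rightarrow> smat \<Rightarrow> smat \<Rightarrow> bool" where
  "gauss_borel M L U \<longleftrightarrow>
     lower_unitriangular L \<and> supper_triangular U \<and> snonsingular U \<and>
     M = sinverse L \<star> sinverse U"

section \<open>Matrices of measures and their moment matrices\<close>

text \<open>A real (possibly signed) measure is given by two nonnegative measures, of which it is the
  difference, for instance its Jordan decomposition. A nonnegative measure has zero second
  component. The moment conditions below, with exponent 0, make both components finite.\<close>

type_synonym real_measure = "real measure \<times> real measure"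

definition real_measure_on :: "real set \<Rightarrow> real_measure \<Rightarrow> bool" where
  "real_measure_on \<Delta> \<nu> \<longleftrightarrow>
     sets (fst \<nu>) = sets (restrict_space borel \<Delta>) \<and> sets (snd \<nu>) = sets (restrict_space borel \<Delta>)"

definition finite_moments :: "real_measure \<Rightarrow> bool" where
  "finite_moments \<nu> \<longleftrightarrow>
     (\<forall>n::nat. integrable (fst \<nu>) (\<lambda>x. x ^ n) \<and> integrable (snd \<nu>) (\<lambda>x. x ^ n))"

definition rm_integral :: "real_measure \<Rightarrow> (real \<Rightarrow> real) \<Rightarrow> real" where
  "rm_integral \<nu> f = integral\<^sup>L (fst \<nu>) f - integral\<^sup>L (snd \<nu>) f"

text \<open>The entries \<open>\<mu> b a\<close> with \<open>b < q\<close>, \<open>a < p\<close> form a \<open>q \<times> p\<close> matrix; finite matrices are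
  indexed from 0.\<close>

definition matrix_of_measures ::
    "nat \<Rightarrow> nat \<Rightarrow> real set \<Rightarrow> (nat \<Rightarrow> nat \<Rightarrow> real_measure) \<Rightarrow> bool" where
  "matrix_of_measures q p \<Delta> \<mu> \<longleftrightarrow>
     (\<forall>b<q. \<forall>a<p. real_measure_on \<Delta> (\<mu> b a) \<and> finite_moments (\<mu> b a))"

text \<open>The semi-infinite column of blocks \<open>I\<^sub>r, x I\<^sub>r, x\<^sup>2 I\<^sub>r, \<dots>\<close>: row \<open>n\<close> is row \<open>n mod r\<close> of the
  block with index \<open>n div r\<close>.\<close>

definition monomial_blocks :: "nat \<Rightarrow> real \<Rightarrow> smat" where
  "monomial_blocks r x = (\<lambda>n b. x ^ (n div r) * 1\<^sub>m r $$ (n mod r, b))"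

text \<open>The moment matrix of the \<open>q \<times> p\<close> matrix of measures \<open>A d\<mu> B\<close>, where \<open>A\<close> and \<open>B\<close> are
  \<open>q \<times> q\<close> and \<open>p \<times> p\<close> matrix-valued functions: the integral of
  \<open>X\<^sub>q(x) A(x) d\<mu>(x) B(x) X\<^sub>p(x)\<^sup>T\<close>. The moment matrix of \<open>d\<mu>\<close> is the case
  in which \<open>A\<close> and \<open>B\<close> are constantly the identity.\<close>

definition moment_matrix ::
    "nat \<Rightarrow> nat \<Rightarrow> (real \<Rightarrow> real mat) \<Rightarrow> (nat \<Rightarrow> nat \<Rightarrow> real_measure) \<Rightarrow> (real \<Rightarrow> real mat) \<Rightarrow> smat"
  where
  "moment_matrix q p A \<mu> B = (\<lambda>i j. \<Sum>b<q. \<Sum>a<p. rm_integral (\<mu> b a)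
     (\<lambda>x. (\<Sum>c<q. monomial_blocks q x i c * A x $$ (c, b)) *
          (\<Sum>d<p. B x $$ (a, d) * monomial_blocks p x j d)))"

definition christoffel_mat :: "nat \<Rightarrow> real \<Rightarrow> real mat" where
  "christoffel_mat r x = mat r r (\<lambda>(i, j).
     if j = Suc i then 1 else if Suc i = r \<and> j = 0 then x else 0)"

definition moment_matrix_L :: "nat \<Rightarrow> nat \<Rightarrow> (nat \<Rightarrow> nat \<Rightarrow> real_measure) \<Rightarrow> nat \<Rightarrow> smat" where
  "moment_matrix_L q p \<mu> k =
     moment_matrix q p (\<lambda>x. 1\<^sub>m q) \<mu> (\<lambda>x. transpose_mat (christoffel_mat p x ^\<^sub>m k))"

definition moment_matrix_R :: "nat \<Rightarrow> nat \<Rightarrow> (nat \<Rightarrow> nat \<Rightarrow> real_measure) \<Rightarrow> nat \<Rightarrow> smat" where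
  "moment_matrix_R q p \<mu> k =
     moment_matrix q p (\<lambda>x. christoffel_mat q x ^\<^sub>m k) \<mu> (\<lambda>x. 1\<^sub>m p)"

section \<open>The recurrence matrix and its bidiagonal factors\<close>

definition recurrence_matrix :: "nat \<Rightarrow> smat \<Rightarrow> smat" where
  "recurrence_matrix q L = L \<star> spow \<Lambda> q \<star> sinverse L"

definition is_lower_factor :: "(nat \<Rightarrow> smat) \<Rightarrow> nat \<Rightarrow> smat \<Rightarrow> bool" where
  "is_lower_factor UL k L \<longleftrightarrow> unit_lower_bidiagonal L \<and>
     sinverse (UL (k - 1)) \<star> stranspose \<Lambda> = L \<star> sinverse (UL k)"

definition is_upper_factor :: "(nat \<Rightarrow> smat) \<Rightarrow> nat \<Rightarrow> smat \<Rightarrow> bool" where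
  "is_upper_factor LR k U \<longleftrightarrow> unit_upper_bidiagonal U \<and>
     \<Lambda> \<star> sinverse (LR (k - 1)) = sinverse (LR k) \<star> U"

definition lower_factor :: "(nat \<Rightarrow> smat) \<Rightarrow> nat \<Rightarrow> smat" where
  "lower_factor UL k = (THE L. is_lower_factor UL k L)"

definition upper_factor :: "(nat \<Rightarrow> smat) \<Rightarrow> nat \<Rightarrow> smat" where
  "upper_factor LR k = (THE U. is_upper_factor LR k U)"

end

theory Submission
  imports Defs
begin

text \<open>If \<open>\<M>\<close> and \<open>\<M>'\<close> have Gauss--Borel factors \<open>\<L>, \<U>\<close> and \<open>\<L>', \<U>'\<close>, then
  \<open>A \<M> = \<M>' B\<close> implies \<open>\<L>' A \<L>\<^sup>-\<^sup>1 = \<U>'\<^sup>-\<^sup>1 B \<U>\<close>. The left-hand side bounds the upper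
  bandwidth of this matrix and the right-hand side its lower bandwidth. With one of \<open>A\<close>, \<open>B\<close> the
  identity and the other a shift, this shows that the factors \<open>L\<^sub>k\<close> and \<open>U\<^sub>k\<close> are bidiagonal; with
  \<open>A = B = I\<close>, it shows that a Gauss--Borel factorization is unique.

  The factors satisfy \<open>L\<^sub>k \<L>\<^sub>L\<^sup>(\<^sup>k\<^sup>) = \<L>\<^sub>L\<^sup>(\<^sup>k\<^sup>-\<^sup>1\<^sup>)\<close> and
  \<open>U\<^sub>k \<L>\<^sub>R\<^sup>(\<^sup>k\<^sup>-\<^sup>1\<^sup>) = \<L>\<^sub>R\<^sup>(\<^sup>k\<^sup>) \<Lambda>\<close>. Hence \<open>L\<^sub>1 \<cdots> L\<^sub>p \<L>\<^sub>L\<^sup>(\<^sup>p\<^sup>) = \<L>\<close> and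
  \<open>U\<^sub>q \<cdots> U\<^sub>1 \<L> = \<L>\<^sub>R\<^sup>(\<^sup>q\<^sup>) \<Lambda>\<^sup>q\<close>. Since \<open>\<Lambda>\<^sup>q \<M> = \<M> (\<Lambda>\<^sup>p)\<^sup>T\<close>, uniqueness gives
  \<open>\<L>\<^sub>L\<^sup>(\<^sup>p\<^sup>) = \<L>\<^sub>R\<^sup>(\<^sup>q\<^sup>)\<close>, so \<open>L\<^sub>1 \<cdots> L\<^sub>p U\<^sub>q \<cdots> U\<^sub>1 \<L> = \<L> \<Lambda>\<^sup>q\<close>.\<close>

section \<open>Products of semi-infinite matrices\<close>

lemma smult_mat_eq_sum:
  assumes "finite S" and "\<And>k. k \<notin> S \<Longrightarrow> A i k * B k j = 0"
  shows "(A \<star> B) i j = (\<Sum>k\<in>S. A i k * B k j)"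
  unfolding smult_mat_def
  by (rule Sum_any.expand_superset) (use assms in auto)

lemma sid_smult_mat [simp]: "sid \<star> A = A"
proof (intro ext)
  fix i j
  show "(sid \<star> A) i j = A i j"
    using smult_mat_eq_sum [of "{i}" sid i A j] by (simp add: sid_def)
qed

lemma smult_mat_sid [simp]: "A \<star> sid = A"
proof (intro ext)
  fix i j
  show "(A \<star> sid) i j = A i j"
    using smult_mat_eq_sum [of "{j}" A i sid j] by (simp add: sid_def)
qed

lemma shift_smult_mat: "(\<Lambda> \<star> A) i j = A (Suc i) j"
  using smult_mat_eq_sum [of "{Suc i}" \<Lambda> i A j] by (simp add: shift_def)

lemma smult_mat_stranspose_shift: "(A \<star> stranspose \<Lambda>) i j = A i (Suc j)"
  using smult_mat_eq_sum [of "{Suc j}" A i "stranspose \<Lambda>" j]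
  by (simp add: shift_def stranspose_def)

lemma smult_mat_assoc:
  assumes "\<And>i j. finite {(k, l). A i k * B k l * C l j \<noteq> 0}"
  shows "A \<star> B \<star> C = A \<star> (B \<star> C)"
proof (intro ext)
  fix i j
  define P where "P = {(k, l). A i k * B k l * C l j \<noteq> 0}"
  have finite: "finite (fst ` P)" "finite (snd ` P)"
    using assms by (simp_all add: P_def)
  have outside: "A i k * B k l * C l j = 0" if "k \<notin> fst ` P \<or> l \<notin> snd ` P" for k l
    using that by (force simp: P_def)
  have left: "(A \<star> B) i l * C l j = (\<Sum>k\<in>fst ` P. A i k * B k l * C l j)" for l
  proof (cases "C l j = 0")
    case False
    then have "(A \<star> B) i l = (\<Sum>k\<in>fst ` P. A i k * B k l)"
      using finite outside by (intro smult_mat_eq_sum) auto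
    then show ?thesis
      by (simp add: sum_distrib_right)
  qed simp
  have right: "A i k * (B \<star> C) k j = (\<Sum>l\<in>snd ` P. A i k * B k l * C l j)" for k
  proof (cases "A i k = 0")
    case False
    then have "(B \<star> C) k j = (\<Sum>l\<in>snd ` P. B k l * C l j)"
      using finite outside by (intro smult_mat_eq_sum) (auto simp: mult.assoc)
    then show ?thesis
      by (simp add: sum_distrib_left mult.assoc)
  qed simp
  have "(A \<star> B \<star> C) i j = (\<Sum>l\<in>snd ` P. (A \<star> B) i l * C l j)"
    using finite outside by (intro smult_mat_eq_sum) (simp_all add: left sum.neutral)
  also have "\<dots> = (\<Sum>k\<in>fst ` P. A i k * (B \<star> C) k j)"
    unfolding left right by (rule sum.swap)
  also have "\<dots> = (A \<star> (B \<star> C)) i j"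
    using finite outside by (intro smult_mat_eq_sum [symmetric]) (simp_all add: right sum.neutral)
  finally show "(A \<star> B \<star> C) i j = (A \<star> (B \<star> C)) i j" .
qed

definition row_finite :: "smat \<Rightarrow> bool" where
  "row_finite A \<longleftrightarrow> (\<forall>i. finite {k. A i k \<noteq> 0})"

definition col_finite :: "smat \<Rightarrow> bool" where
  "col_finite A \<longleftrightarrow> (\<forall>j. finite {k. A k j \<noteq> 0})"

lemma smult_mat_assoc_row_row:
  assumes "row_finite A" "row_finite B"
  shows "A \<star> B \<star> C = A \<star> (B \<star> C)"
proof (rule smult_mat_assoc)
  fix i j
  have "finite (SIGMA k:{k. A i k \<noteq> 0}. {l. B k l \<noteq> 0})"
    using assms by (simp add: row_finite_def)
  then show "finite {(k, l). A i k * B k l * C l j \<noteq> 0}"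
    by (rule rev_finite_subset) auto
qed

lemma smult_mat_assoc_row_col:
  assumes "row_finite A" "col_finite C"
  shows "A \<star> B \<star> C = A \<star> (B \<star> C)"
proof (rule smult_mat_assoc)
  fix i j
  have "finite ({k. A i k \<noteq> 0} \<times> {l. C l j \<noteq> 0})"
    using assms by (simp add: row_finite_def col_finite_def)
  then show "finite {(k, l). A i k * B k l * C l j \<noteq> 0}"
    by (rule rev_finite_subset) auto
qed

lemma smult_mat_assoc_col_col:
  assumes "col_finite B" "col_finite C"
  shows "A \<star> B \<star> C = A \<star> (B \<star> C)"
proof (rule smult_mat_assoc)
  fix i j
  have "finite ((SIGMA l:{l. C l j \<noteq> 0}. {k. B k l \<noteq> 0})\<inverse>)"
    using assms by (simp add: col_finite_def)
  then show "finite {(k, l). A i k * B k l * C l j \<noteq> 0}"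
    by (rule rev_finite_subset) auto
qed

lemma row_finite_smult_mat:
  assumes "row_finite A" "row_finite B"
  shows "row_finite (A \<star> B)"
  unfolding row_finite_def
proof
  fix i
  define S where "S = (\<Union>k\<in>{k. A i k \<noteq> 0}. {l. B k l \<noteq> 0})"
  have "(A \<star> B) i l = 0" if "l \<notin> S" for l
    using that smult_mat_eq_sum [of "{}" A i B l] by (auto simp: S_def)
  then have "{l. (A \<star> B) i l \<noteq> 0} \<subseteq> S"
    by blast
  moreover have "finite S"
    using assms by (auto simp: S_def row_finite_def)
  ultimately show "finite {l. (A \<star> B) i l \<noteq> 0}"
    by (rule finite_subset)
qed

lemma row_finite_sid: "row_finite sid"
  by (simp add: row_finite_def sid_def)

lemma col_finite_sid: "col_finite sid"
  by (simp add: col_finite_def sid_def)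

lemma row_finite_shift: "row_finite \<Lambda>"
  by (simp add: row_finite_def shift_def)

lemma col_finite_stranspose_shift: "col_finite (stranspose \<Lambda>)"
  by (simp add: col_finite_def shift_def stranspose_def)

lemma row_finite_spow: "row_finite A \<Longrightarrow> row_finite (spow A n)"
  by (induction n) (simp_all add: row_finite_sid row_finite_smult_mat)

lemma sprod_Nil [simp]: "sprod [] = sid"
  by (simp add: sprod_def)

lemma sprod_Cons [simp]: "sprod (A # As) = A \<star> sprod As"
  by (simp add: sprod_def)

lemma row_finite_sprod: "\<forall>A\<in>set As. row_finite A \<Longrightarrow> row_finite (sprod As)"
  by (induction As) (simp_all add: row_finite_sid row_finite_smult_mat)

lemma sprod_append:
  "\<forall>A\<in>set As. row_finite A \<Longrightarrow> sprod (As @ Bs) = sprod As \<star> sprod Bs"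
  by (induction As) (simp_all add: smult_mat_assoc_row_row row_finite_sprod)

lemma sprod_telescope:
  assumes "\<And>k. k < n \<Longrightarrow> row_finite (F k)"
    and "\<And>k. k < n \<Longrightarrow> F k \<star> X (Suc k) = X k"
  shows "sprod (map F [0..<n]) \<star> X n = X 0"
  using assms
proof (induction n)
  case (Suc n)
  let ?P = "sprod (map F [0..<n])"
  have "row_finite ?P"
    using Suc.prems(1) by (simp add: row_finite_sprod)
  have "sprod (map F [0..<Suc n]) \<star> X (Suc n) = ?P \<star> F n \<star> X (Suc n)"
    using Suc.prems(1) by (simp add: sprod_append)
  also have "\<dots> = ?P \<star> X n"
    using \<open>row_finite ?P\<close> Suc.prems by (simp add: smult_mat_assoc_row_row)
  also have "\<dots> = X 0"
    using Suc by simp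
  finally show ?case .
qed simp

lemma sprod_rev_intertwine:
  assumes "row_finite B" and "\<And>k. k \<le> n \<Longrightarrow> row_finite (X k)"
    and "\<And>k. k < n \<Longrightarrow> row_finite (F k)"
    and "\<And>k. k < n \<Longrightarrow> F k \<star> X k = X (Suc k) \<star> B"
  shows "sprod (map F (rev [0..<n])) \<star> X 0 = X n \<star> spow B n"
  using assms(2-)
proof (induction n)
  case (Suc n)
  let ?P = "sprod (map F (rev [0..<n]))"
  have "row_finite ?P"
    using Suc.prems(2) by (simp add: row_finite_sprod)
  then have "sprod (map F (rev [0..<Suc n])) \<star> X 0 = F n \<star> (?P \<star> X 0)"
    using Suc.prems(2) by (simp add: smult_mat_assoc_row_row)
  also have "\<dots> = F n \<star> (X n \<star> spow B n)"
    using Suc by simp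
  also have "\<dots> = F n \<star> X n \<star> spow B n"
    using Suc.prems(1,2) by (simp add: smult_mat_assoc_row_row)
  also have "\<dots> = X (Suc n) \<star> B \<star> spow B n"
    by (simp add: Suc.prems(3))
  also have "\<dots> = X (Suc n) \<star> spow B (Suc n)"
    using Suc.prems(1) \<open>row_finite B\<close> by (simp add: smult_mat_assoc_row_row)
  finally show ?case .
qed simp

section \<open>Banded and triangular matrices\<close>

definition unit_upper_bandwidth :: "nat \<Rightarrow> smat \<Rightarrow> bool" where
  "unit_upper_bandwidth m A \<longleftrightarrow> (\<forall>i. A i (i + m) = 1) \<and> (\<forall>i j. i + m < j \<longrightarrow> A i j = 0)"

definition lower_bandwidth :: "nat \<Rightarrow> smat \<Rightarrow> bool" where
  "lower_bandwidth n A \<longleftrightarrow> (\<forall>i j. j + n < i \<longrightarrow> A i j = 0)"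

lemma unit_upper_bandwidth_0: "unit_upper_bandwidth 0 A \<longleftrightarrow> lower_unitriangular A"
  by (simp add: unit_upper_bandwidth_def lower_unitriangular_def)

lemma lower_bandwidth_0: "lower_bandwidth 0 A \<longleftrightarrow> supper_triangular A"
  by (simp add: lower_bandwidth_def supper_triangular_def)

lemma unit_lower_bidiagonal_iff:
  "unit_lower_bidiagonal A \<longleftrightarrow> unit_upper_bandwidth 0 A \<and> lower_bandwidth 1 A"
  unfolding unit_lower_bidiagonal_def unit_upper_bandwidth_def lower_bandwidth_def
  by (auto simp: nat_neq_iff)

lemma unit_upper_bidiagonal_iff:
  "unit_upper_bidiagonal A \<longleftrightarrow> unit_upper_bandwidth 1 A \<and> lower_bandwidth 0 A"
  unfolding unit_upper_bidiagonal_def unit_upper_bandwidth_def lower_bandwidth_def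
  by (auto simp: nat_neq_iff)

lemma unit_upper_bandwidth_shift: "unit_upper_bandwidth 1 \<Lambda>"
  by (simp add: unit_upper_bandwidth_def shift_def)

lemma lower_bandwidth_stranspose_shift: "lower_bandwidth 1 (stranspose \<Lambda>)"
  by (simp add: lower_bandwidth_def shift_def stranspose_def)

lemma row_finite_unit_upper_bandwidth:
  assumes "unit_upper_bandwidth m A"
  shows "row_finite A"
  unfolding row_finite_def
proof
  fix i
  have "{k. A i k \<noteq> 0} \<subseteq> {..i + m}"
    using assms by (auto simp: unit_upper_bandwidth_def not_less [symmetric])
  then show "finite {k. A i k \<noteq> 0}"
    by (rule finite_subset) simp
qed

lemma col_finite_lower_bandwidth:
  assumes "lower_bandwidth n A"
  shows "col_finite A"
  unfolding col_finite_def
proof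
  fix j
  have "{k. A k j \<noteq> 0} \<subseteq> {..j + n}"
    using assms by (auto simp: lower_bandwidth_def not_less [symmetric])
  then show "finite {k. A k j \<noteq> 0}"
    by (rule finite_subset) simp
qed

lemmas row_finite_lower_unitriangular =
  row_finite_unit_upper_bandwidth [of 0, unfolded unit_upper_bandwidth_0]

lemmas col_finite_supper_triangular =
  col_finite_lower_bandwidth [of 0, unfolded lower_bandwidth_0]

lemma unit_upper_bandwidth_smult_mat:
  assumes band_A: "unit_upper_bandwidth m A" and band_B: "unit_upper_bandwidth n B"
  shows "unit_upper_bandwidth (m + n) (A \<star> B)"
proof -
  have "(A \<star> B) i (i + (m + n)) = 1" for i
  proof -
    have "A i k * B k (i + (m + n)) = 0" if "k \<noteq> i + m" for k
      using band_A band_B that by (auto simp: unit_upper_bandwidth_def nat_neq_iff)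
    then have "(A \<star> B) i (i + (m + n)) = A i (i + m) * B (i + m) (i + m + n)"
      using smult_mat_eq_sum [of "{i + m}" A i B "i + (m + n)"] by (simp add: add.assoc)
    then show ?thesis
      using band_A band_B by (simp add: unit_upper_bandwidth_def)
  qed
  moreover have "(A \<star> B) i j = 0" if "i + (m + n) < j" for i j
  proof -
    have "A i k * B k j = 0" for k
    proof (cases "i + m < k")
      case False
      then have "k + n < j"
        using that by linarith
      then show ?thesis
        using band_B by (simp add: unit_upper_bandwidth_def)
    qed (use band_A in \<open>simp add: unit_upper_bandwidth_def\<close>)
    then show ?thesis
      by (simp add: smult_mat_eq_sum [of "{}"])
  qed
  ultimately show ?thesis
    by (simp add: unit_upper_bandwidth_def)
qed

lemma lower_bandwidth_smult_mat:
  assumes band_A: "lower_bandwidth m A" and band_B: "lower_bandwidth n B"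
  shows "lower_bandwidth (m + n) (A \<star> B)"
  unfolding lower_bandwidth_def
proof (intro allI impI)
  fix i j assume less: "j + (m + n) < i"
  have "A i k * B k j = 0" for k
  proof (cases "k + m < i")
    case False
    then have "j + n < k"
      using less by linarith
    then show ?thesis
      using band_B by (simp add: lower_bandwidth_def)
  qed (use band_A in \<open>simp add: lower_bandwidth_def\<close>)
  then show "(A \<star> B) i j = 0"
    by (simp add: smult_mat_eq_sum [of "{}"])
qed

lemma lower_unitriangular_smult_mat_eq_sum:
  assumes "lower_unitriangular A"
  shows "(A \<star> B) i j = (\<Sum>k<i. A i k * B k j) + B i j"
proof -
  have "(A \<star> B) i j = (\<Sum>k\<le>i. A i k * B k j)"
    using assms by (intro smult_mat_eq_sum) (auto simp: lower_unitriangular_def)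
  then show ?thesis
    using assms by (simp add: lessThan_Suc_atMost [symmetric] lower_unitriangular_def)
qed

lemma smult_mat_supper_triangular_eq_sum:
  assumes "supper_triangular U"
  shows "(B \<star> U) i j = (\<Sum>k<j. B i k * U k j) + B i j * U j j"
proof -
  have "(B \<star> U) i j = (\<Sum>k\<le>j. B i k * U k j)"
    using assms by (intro smult_mat_eq_sum) (auto simp: supper_triangular_def)
  then show ?thesis
    by (simp add: lessThan_Suc_atMost [symmetric])
qed

section \<open>Inverses of triangular matrices\<close>

lemma sinverse_eqI:
  assumes "is_sinverse A B" and "\<And>D. is_sinverse A D \<Longrightarrow> B \<star> A \<star> D = B \<star> (A \<star> D)"
  shows "sinverse A = B"
  unfolding sinverse_def
proof (rule the_equality)
  fix D assume D: "is_sinverse A D"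
  then have "B \<star> A \<star> D = B \<star> (A \<star> D)"
    by (rule assms(2))
  then show "D = B"
    using assms(1) D by (simp add: is_sinverse_def)
qed (fact assms(1))

fun forward_substitution :: "smat \<Rightarrow> smat" where
  "forward_substitution A i j = sid i j - (\<Sum>k<i. A i k * forward_substitution A k j)"

declare forward_substitution.simps [simp del]

lemma smult_mat_forward_substitution:
  assumes "lower_unitriangular A"
  shows "A \<star> forward_substitution A = sid"
proof (intro ext)
  fix i j
  show "(A \<star> forward_substitution A) i j = sid i j"
    using assms forward_substitution.simps [of A i j]
    by (simp add: lower_unitriangular_smult_mat_eq_sum)
qed

lemma lower_unitriangular_forward_substitution: "lower_unitriangular (forward_substitution A)"
proof -
  have above_diagonal: "forward_substitution A i j = 0" if "i < j" for i j
    using that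
  proof (induction i rule: less_induct)
    case (less i)
    have "(\<Sum>k<i. A i k * forward_substitution A k j) = 0"
      using less by (intro sum.neutral) auto
    then show ?case
      using less.prems by (simp add: forward_substitution.simps [of A i j] sid_def)
  qed
  have "forward_substitution A i i = 1" for i
    by (simp add: forward_substitution.simps [of A i i] above_diagonal sid_def)
  with above_diagonal show ?thesis
    by (simp add: lower_unitriangular_def)
qed

lemma lower_unitriangular_sinverse:
  assumes lower: "lower_unitriangular A"
  shows "lower_unitriangular (sinverse A)" "is_sinverse A (sinverse A)"
proof -
  let ?B = "forward_substitution A"
  let ?C = "forward_substitution ?B"
  have substitution: "lower_unitriangular ?B" "A \<star> ?B = sid" "?B \<star> ?C = sid"
    using lower
    by (simp_all add: lower_unitriangular_forward_substitution smult_mat_forward_substitution)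
  note assoc = smult_mat_assoc_row_row [OF row_finite_lower_unitriangular
      row_finite_lower_unitriangular]
  have "?C = A"
    using assoc [OF lower substitution(1), of ?C] substitution by simp
  with substitution have inverse: "is_sinverse A ?B"
    by (simp add: is_sinverse_def)
  then have "sinverse A = ?B"
    by (rule sinverse_eqI) (rule assoc [OF substitution(1) lower])
  with substitution(1) inverse show "lower_unitriangular (sinverse A)" "is_sinverse A (sinverse A)"
    by simp_all
qed

lemma supper_triangular_left_inverse:
  assumes upper: "supper_triangular U" and inverse: "B \<star> U = sid"
  shows "supper_triangular B"
proof -
  have "\<forall>i>j. B i j = 0" for j
  proof (induction j rule: less_induct)
    case (less j)
    have entry: "B i j * U j j = sid i j" if "j \<le> i" for i
    proof -
      have "(\<Sum>k<j. B i k * U k j) = 0"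
        using less that by (intro sum.neutral) auto
      then show ?thesis
        using smult_mat_supper_triangular_eq_sum [OF upper, of B i j] inverse by simp
    qed
    from entry [of j] have "U j j \<noteq> 0"
      by (auto simp: sid_def)
    moreover have "B i j * U j j = 0" if "j < i" for i
      using entry [of i] that by (simp add: sid_def)
    ultimately show ?case
      by simp
  qed
  then show ?thesis
    by (simp add: supper_triangular_def)
qed

lemma supper_triangular_sinverse:
  assumes upper: "supper_triangular U" and "snonsingular U"
  shows "supper_triangular (sinverse U)" "is_sinverse U (sinverse U)"
proof -
  obtain B where inverse: "is_sinverse U B"
    using assms(2) by (auto simp: snonsingular_def)
  have upper_inverse: "supper_triangular D" if "is_sinverse U D" for D
    using that supper_triangular_left_inverse [OF upper] by (simp add: is_sinverse_def)
  have "sinverse U = B"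
    using inverse by (rule sinverse_eqI)
      (intro smult_mat_assoc_col_col col_finite_supper_triangular upper upper_inverse)
  with inverse upper_inverse show "supper_triangular (sinverse U)" "is_sinverse U (sinverse U)"
    by simp_all
qed

lemma eq_sinverse_lower_smult_iff:
  assumes "lower_unitriangular L"
  shows "X = sinverse L \<star> Y \<longleftrightarrow> L \<star> X = Y"
proof -
  note inverse = lower_unitriangular_sinverse [OF assms]
  have "L \<star> (sinverse L \<star> Y) = Y" "sinverse L \<star> (L \<star> X) = X"
    using assms inverse
    by (simp_all add: is_sinverse_def row_finite_lower_unitriangular
        smult_mat_assoc_row_row [symmetric])
  then show ?thesis
    by auto
qed

lemma eq_smult_sinverse_lower_iff:
  assumes "lower_unitriangular L" "row_finite X" "row_finite Y"
  shows "X = Y \<star> sinverse L \<longleftrightarrow> X \<star> L = Y"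
proof -
  note inverse = lower_unitriangular_sinverse [OF assms(1)]
  have "Y \<star> sinverse L \<star> L = Y" "X \<star> L \<star> sinverse L = X"
    using assms inverse
    by (simp_all add: is_sinverse_def row_finite_lower_unitriangular smult_mat_assoc_row_row)
  then show ?thesis
    by auto
qed

lemma eq_smult_sinverse_upper_iff:
  assumes "supper_triangular U" "snonsingular U"
  shows "X = Y \<star> sinverse U \<longleftrightarrow> X \<star> U = Y"
proof -
  note inverse = supper_triangular_sinverse [OF assms]
  have "Y \<star> sinverse U \<star> U = Y" "X \<star> U \<star> sinverse U = X"
    using assms inverse
    by (simp_all add: is_sinverse_def col_finite_supper_triangular smult_mat_assoc_col_col)
  then show ?thesis
    by auto
qed

section \<open>Gauss--Borel factorizations\<close>

lemma gauss_borelD: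
  assumes "gauss_borel M L U"
  shows "lower_unitriangular L" "supper_triangular U" "snonsingular U"
    and "L \<star> M = sinverse U" "M \<star> U = sinverse L"
proof -
  show lower: "lower_unitriangular L" and upper: "supper_triangular U" "snonsingular U"
    using assms by (simp_all add: gauss_borel_def)
  have factorization: "M = sinverse L \<star> sinverse U"
    using assms by (simp add: gauss_borel_def)
  then show "L \<star> M = sinverse U"
    by (simp only: eq_sinverse_lower_smult_iff [OF lower])
  from factorization show "M \<star> U = sinverse L"
    by (simp only: eq_smult_sinverse_upper_iff [OF upper])
qed

lemma gauss_borel_intertwine:
  assumes "gauss_borel M L U" "gauss_borel M' L' U'"
    and "row_finite A" "col_finite B" and intertwine: "A \<star> M = M' \<star> B"
  shows "L' \<star> A \<star> sinverse L = sinverse U' \<star> B \<star> U"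
proof -
  note unprimed = gauss_borelD [OF assms(1)] and primed = gauss_borelD [OF assms(2)]
  note finite = row_finite_lower_unitriangular [OF primed(1)]
    col_finite_supper_triangular [OF unprimed(2)] assms(3,4)
  have "L' \<star> A \<star> sinverse L = L' \<star> A \<star> M \<star> U"
    by (simp add: unprimed(5) [symmetric] smult_mat_assoc_row_col row_finite_smult_mat finite)
  also have "L' \<star> A \<star> M = L' \<star> M' \<star> B"
    by (simp add: smult_mat_assoc_row_row smult_mat_assoc_row_col finite intertwine)
  finally show ?thesis
    by (simp add: primed(4))
qed

lemma gauss_borel_lower_unique:
  assumes "gauss_borel M L U" "gauss_borel M L' U'"
  shows "L = L'"
proof -
  note unprimed = gauss_borelD [OF assms(1)] and primed = gauss_borelD [OF assms(2)]
  have "L' \<star> sinverse L = sinverse U' \<star> U"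
    using gauss_borel_intertwine [OF assms row_finite_sid col_finite_sid] by simp
  moreover have "supper_triangular (sinverse U' \<star> U)"
    using lower_bandwidth_smult_mat [of 0 "sinverse U'" 0 U] unprimed primed
      supper_triangular_sinverse
    by (simp add: lower_bandwidth_0)
  moreover have "lower_unitriangular (L' \<star> sinverse L)"
    using unit_upper_bandwidth_smult_mat [of 0 L' 0 "sinverse L"] unprimed primed
      lower_unitriangular_sinverse
    by (simp add: unit_upper_bandwidth_0)
  ultimately have "sid = L' \<star> sinverse L"
    by (auto simp: supper_triangular_def lower_unitriangular_def sid_def fun_eq_iff
        dest: nat_neq_iff [THEN iffD1])
  then show ?thesis
    using eq_smult_sinverse_lower_iff [OF unprimed(1) row_finite_sid, of L'] primed
    by (simp add: row_finite_lower_unitriangular)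
qed

section \<open>The bidiagonal factors\<close>

lemma unit_lower_bidiagonal_connection:
  assumes "gauss_borel M L U" "gauss_borel (M \<star> stranspose \<Lambda>) L' U'"
  shows "L \<star> sinverse L' = sinverse U \<star> stranspose \<Lambda> \<star> U'"
    and "unit_lower_bidiagonal (L \<star> sinverse L')"
proof -
  note unprimed = gauss_borelD [OF assms(1)] and primed = gauss_borelD [OF assms(2)]
  show connection: "L \<star> sinverse L' = sinverse U \<star> stranspose \<Lambda> \<star> U'"
    using gauss_borel_intertwine [OF assms(2,1) row_finite_sid col_finite_stranspose_shift]
    by simp
  have "unit_upper_bandwidth (0 + 0) (L \<star> sinverse L')"
    by (intro unit_upper_bandwidth_smult_mat)
      (simp_all add: unit_upper_bandwidth_0 unprimed primed lower_unitriangular_sinverse)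
  moreover have "lower_bandwidth (0 + 1 + 0) (sinverse U \<star> stranspose \<Lambda> \<star> U')"
    by (intro lower_bandwidth_smult_mat lower_bandwidth_stranspose_shift)
      (simp_all add: lower_bandwidth_0 unprimed primed supper_triangular_sinverse)
  ultimately show "unit_lower_bidiagonal (L \<star> sinverse L')"
    by (simp add: unit_lower_bidiagonal_iff connection)
qed

lemma unit_upper_bidiagonal_connection:
  assumes "gauss_borel M L U" "gauss_borel (\<Lambda> \<star> M) L' U'"
  shows "unit_upper_bidiagonal (L' \<star> \<Lambda> \<star> sinverse L)"
proof -
  note unprimed = gauss_borelD [OF assms(1)] and primed = gauss_borelD [OF assms(2)]
  have connection: "L' \<star> \<Lambda> \<star> sinverse L = sinverse U' \<star> U"
    using gauss_borel_intertwine [OF assms row_finite_shift col_finite_sid] by simp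
  have "unit_upper_bandwidth (0 + 1 + 0) (L' \<star> \<Lambda> \<star> sinverse L)"
    by (intro unit_upper_bandwidth_smult_mat unit_upper_bandwidth_shift)
      (simp_all add: unit_upper_bandwidth_0 unprimed primed lower_unitriangular_sinverse)
  moreover have "lower_bandwidth (0 + 0) (sinverse U' \<star> U)"
    by (intro lower_bandwidth_smult_mat)
      (simp_all add: lower_bandwidth_0 unprimed primed supper_triangular_sinverse)
  ultimately show ?thesis
    by (simp add: unit_upper_bidiagonal_iff connection)
qed

lemma is_lower_factor_Suc_iff:
  assumes "gauss_borel M (LL k) (UL k)"
    and "gauss_borel (M \<star> stranspose \<Lambda>) (LL (Suc k)) (UL (Suc k))"
  shows "is_lower_factor UL (Suc k) L \<longleftrightarrow> L = LL k \<star> sinverse (LL (Suc k))"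
proof -
  have "is_lower_factor UL (Suc k) L \<longleftrightarrow>
      unit_lower_bidiagonal L \<and> L = sinverse (UL k) \<star> stranspose \<Lambda> \<star> UL (Suc k)"
    using eq_smult_sinverse_upper_iff [OF gauss_borelD(2,3) [OF assms(2)]]
    by (auto simp: is_lower_factor_def)
  then show ?thesis
    using unit_lower_bidiagonal_connection [OF assms] by auto
qed

lemma is_upper_factor_Suc_iff:
  assumes "gauss_borel M (LR k) (UR k)"
    and "gauss_borel (\<Lambda> \<star> M) (LR (Suc k)) (UR (Suc k))"
  shows "is_upper_factor LR (Suc k) U \<longleftrightarrow> U = LR (Suc k) \<star> \<Lambda> \<star> sinverse (LR k)"
proof -
  note lower = gauss_borelD(1) [OF assms(2)]
  have "is_upper_factor LR (Suc k) U \<longleftrightarrow>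
      unit_upper_bidiagonal U \<and> U = LR (Suc k) \<star> (\<Lambda> \<star> sinverse (LR k))"
    using eq_sinverse_lower_smult_iff [OF lower]
    by (auto simp: is_upper_factor_def)
  then show ?thesis
    using unit_upper_bidiagonal_connection [OF assms]
    by (auto simp: smult_mat_assoc_row_row row_finite_lower_unitriangular lower row_finite_shift)
qed

lemma lower_factor_Suc:
  assumes "gauss_borel M (LL k) (UL k)"
    and "gauss_borel (M \<star> stranspose \<Lambda>) (LL (Suc k)) (UL (Suc k))"
  shows "\<exists>!L. is_lower_factor UL (Suc k) L"
    and "row_finite (lower_factor UL (Suc k))"
    and "lower_factor UL (Suc k) \<star> LL (Suc k) = LL k"
proof -
  show "\<exists>!L. is_lower_factor UL (Suc k) L"
    unfolding is_lower_factor_Suc_iff [OF assms] by simp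
  note lower = gauss_borelD(1) [OF assms(1)] and lower' = gauss_borelD(1) [OF assms(2)]
  have factor_eq: "lower_factor UL (Suc k) = LL k \<star> sinverse (LL (Suc k))"
    by (simp add: lower_factor_def is_lower_factor_Suc_iff [OF assms])
  then show row_finite: "row_finite (lower_factor UL (Suc k))"
    by (simp add: row_finite_smult_mat row_finite_lower_unitriangular lower lower'
        lower_unitriangular_sinverse)
  show "lower_factor UL (Suc k) \<star> LL (Suc k) = LL k"
    using factor_eq eq_smult_sinverse_lower_iff
      [OF lower' row_finite row_finite_lower_unitriangular [OF lower]]
    by blast
qed

lemma upper_factor_Suc:
  assumes "gauss_borel M (LR k) (UR k)"
    and "gauss_borel (\<Lambda> \<star> M) (LR (Suc k)) (UR (Suc k))"
  shows "\<exists>!U. is_upper_factor LR (Suc k) U"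
    and "row_finite (upper_factor LR (Suc k))"
    and "upper_factor LR (Suc k) \<star> LR k = LR (Suc k) \<star> \<Lambda>"
proof -
  show "\<exists>!U. is_upper_factor LR (Suc k) U"
    unfolding is_upper_factor_Suc_iff [OF assms] by simp
  note lower = gauss_borelD(1) [OF assms(1)] and lower' = gauss_borelD(1) [OF assms(2)]
  have factor_eq: "upper_factor LR (Suc k) = LR (Suc k) \<star> \<Lambda> \<star> sinverse (LR k)"
    by (simp add: upper_factor_def is_upper_factor_Suc_iff [OF assms])
  have row_finite_shifted: "row_finite (LR (Suc k) \<star> \<Lambda>)"
    by (intro row_finite_smult_mat row_finite_lower_unitriangular lower' row_finite_shift)
  with factor_eq show row_finite: "row_finite (upper_factor LR (Suc k))"
    by (simp add: row_finite_smult_mat row_finite_lower_unitriangular lower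
        lower_unitriangular_sinverse)
  show "upper_factor LR (Suc k) \<star> LR k = LR (Suc k) \<star> \<Lambda>"
    using factor_eq eq_smult_sinverse_lower_iff [OF lower row_finite row_finite_shifted] by blast
qed

lemma map_upt_Suc_Suc: "map f [Suc m..<Suc n] = map (\<lambda>k. f (Suc k)) [m..<n]"
  by (simp add: map_Suc_upt [symmetric] comp_def del: upt_Suc)

lemma lower_factor_chain:
  assumes gauss_borel: "\<And>k. k \<le> n \<Longrightarrow> gauss_borel (M k) (LL k) (UL k)"
    and M_Suc: "\<And>k. M (Suc k) = M k \<star> stranspose \<Lambda>"
  shows "\<forall>k\<in>{1..n}. \<exists>!L. is_lower_factor UL k L"
    and "\<forall>A\<in>set (map (lower_factor UL) [1..<Suc n]). row_finite A"
    and "sprod (map (lower_factor UL) [1..<Suc n]) \<star> LL n = LL 0"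
proof -
  have factor: "\<exists>!L. is_lower_factor UL (Suc k) L" "row_finite (lower_factor UL (Suc k))"
    "lower_factor UL (Suc k) \<star> LL (Suc k) = LL k" if "k < n" for k
    using lower_factor_Suc [of "M k" LL k UL] gauss_borel [of k] gauss_borel [of "Suc k"] that
    by (simp_all add: M_Suc)
  then show "\<forall>k\<in>{1..n}. \<exists>!L. is_lower_factor UL k L"
    unfolding image_Suc_lessThan [symmetric] by blast
  have factors: "map (lower_factor UL) [1..<Suc n] = map (\<lambda>k. lower_factor UL (Suc k)) [0..<n]"
    by (simp add: map_upt_Suc_Suc del: upt_Suc)
  show "\<forall>A\<in>set (map (lower_factor UL) [1..<Suc n]). row_finite A"
    unfolding factors using factor(2) by simp
  show "sprod (map (lower_factor UL) [1..<Suc n]) \<star> LL n = LL 0"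
    unfolding factors by (intro sprod_telescope factor(2,3))
qed

lemma upper_factor_chain:
  assumes gauss_borel: "\<And>k. k \<le> n \<Longrightarrow> gauss_borel (M k) (LR k) (UR k)"
    and M_Suc: "\<And>k. M (Suc k) = \<Lambda> \<star> M k"
  shows "\<forall>k\<in>{1..n}. \<exists>!U. is_upper_factor LR k U"
    and "\<forall>A\<in>set (map (upper_factor LR) (rev [1..<Suc n])). row_finite A"
    and "sprod (map (upper_factor LR) (rev [1..<Suc n])) \<star> LR 0 = LR n \<star> spow \<Lambda> n"
proof -
  have factor: "\<exists>!U. is_upper_factor LR (Suc k) U" "row_finite (upper_factor LR (Suc k))"
    "upper_factor LR (Suc k) \<star> LR k = LR (Suc k) \<star> \<Lambda>" if "k < n" for k
    using upper_factor_Suc [of "M k" LR k UR] gauss_borel [of k] gauss_borel [of "Suc k"] that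
    by (simp_all add: M_Suc)
  then show "\<forall>k\<in>{1..n}. \<exists>!U. is_upper_factor LR k U"
    unfolding image_Suc_lessThan [symmetric] by blast
  have factors: "map (upper_factor LR) (rev [1..<Suc n]) =
      map (\<lambda>k. upper_factor LR (Suc k)) (rev [0..<n])"
    by (simp add: map_upt_Suc_Suc rev_map [symmetric] del: upt_Suc)
  show "\<forall>A\<in>set (map (upper_factor LR) (rev [1..<Suc n])). row_finite A"
    unfolding factors using factor(2) by simp
  have "row_finite (LR k)" if "k \<le> n" for k
    using gauss_borelD(1) [OF gauss_borel [OF that]] by (rule row_finite_lower_unitriangular)
  then show "sprod (map (upper_factor LR) (rev [1..<Suc n])) \<star> LR 0 = LR n \<star> spow \<Lambda> n"
    unfolding factors
    by (intro sprod_rev_intertwine row_finite_shift factor(2,3))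
qed

section \<open>Moment matrices of the Christoffel perturbations\<close>

unbundle no vec_syntax

definition monomial_vec :: "nat \<Rightarrow> real \<Rightarrow> nat \<Rightarrow> real vec" where
  "monomial_vec r x n = vec r (monomial_blocks r x n)"

lemma monomial_vec_carrier [simp]: "monomial_vec r x n \<in> carrier_vec r"
  by (simp add: monomial_vec_def)

lemma monomial_vec_eq_smult_unit_vec:
  "monomial_vec r x n = x ^ (n div r) \<cdot>\<^sub>v unit_vec r (n mod r)"
  by (rule eq_vecI) (auto simp: monomial_vec_def monomial_blocks_def unit_vec_def)

lemma monomial_vec_add_period: "monomial_vec r x (n + r) = x \<cdot>\<^sub>v monomial_vec r x n"
  by (rule eq_vecI) (auto simp: monomial_vec_eq_smult_unit_vec)

lemma christoffel_mat_carrier [simp]: "christoffel_mat r x \<in> carrier_mat r r"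
  by (simp add: christoffel_mat_def)

lemma transpose_christoffel_mat_mult_monomial_vec:
  "transpose_mat (christoffel_mat r x) *\<^sub>v monomial_vec r x n = monomial_vec r x (Suc n)"
proof (rule eq_vecI)
  fix b assume "b < dim_vec (monomial_vec r x (Suc n))"
  then have b: "b < r" "n mod r < r"
    by (auto simp: monomial_vec_def)
  have "(transpose_mat (christoffel_mat r x) *\<^sub>v monomial_vec r x n) $ b =
      x ^ (n div r) * christoffel_mat r x $$ (n mod r, b)"
    using b by (simp add: monomial_vec_eq_smult_unit_vec christoffel_mat_def)
  also have "\<dots> = monomial_vec r x (Suc n) $ b"
    using b
    by (auto simp: monomial_vec_eq_smult_unit_vec christoffel_mat_def unit_vec_def mod_Suc div_Suc)
  finally show "(transpose_mat (christoffel_mat r x) *\<^sub>v monomial_vec r x n) $ b =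
      monomial_vec r x (Suc n) $ b" .
qed (simp add: christoffel_mat_def monomial_vec_def)

lemma transpose_christoffel_pow_mult_monomial_vec:
  "transpose_mat (christoffel_mat r x ^\<^sub>m k) *\<^sub>v monomial_vec r x n = monomial_vec r x (n + k)"
proof (induction k)
  case 0
  then show ?case
    by (simp add: christoffel_mat_def)
next
  case (Suc k)
  let ?C = "christoffel_mat r x"
  have "transpose_mat (?C ^\<^sub>m Suc k) *\<^sub>v monomial_vec r x n =
      transpose_mat ?C *\<^sub>v (transpose_mat (?C ^\<^sub>m k) *\<^sub>v monomial_vec r x n)"
    by (simp add: transpose_mult [of _ r r _ r] assoc_mult_mat_vec [of _ r r _ r])
  then show ?case
    by (simp add: Suc.IH transpose_christoffel_mat_mult_monomial_vec)
qed

lemma moment_matrix_eq_monomial_vec: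
  assumes "\<And>x. A x \<in> carrier_mat q q" "\<And>x. B x \<in> carrier_mat p p"
  shows "moment_matrix q p A \<mu> B i j = (\<Sum>b<q. \<Sum>a<p. rm_integral (\<mu> b a)
    (\<lambda>x. (transpose_mat (A x) *\<^sub>v monomial_vec q x i) $ b * (B x *\<^sub>v monomial_vec p x j) $ a))"
proof -
  have "(\<Sum>c<q. monomial_blocks q x i c * A x $$ (c, b)) =
      (transpose_mat (A x) *\<^sub>v monomial_vec q x i) $ b" if "b < q" for b x
    using that assms(1) [of x]
    by (simp add: monomial_vec_def scalar_prod_def atLeast0LessThan mult.commute)
  moreover have "(\<Sum>d<p. B x $$ (a, d) * monomial_blocks p x j d) =
      (B x *\<^sub>v monomial_vec p x j) $ a" if "a < p" for a x
    using that assms(2) [of x] by (simp add: monomial_vec_def scalar_prod_def atLeast0LessThan)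
  ultimately show ?thesis
    unfolding moment_matrix_def by (intro sum.cong refl) simp
qed

definition block_moment ::
    "nat \<Rightarrow> nat \<Rightarrow> (nat \<Rightarrow> nat \<Rightarrow> real_measure) \<Rightarrow> nat \<Rightarrow> nat \<Rightarrow> real" where
  "block_moment q p \<mu> i j = (\<Sum>b<q. \<Sum>a<p. rm_integral (\<mu> b a)
     (\<lambda>x. monomial_vec q x i $ b * monomial_vec p x j $ a))"

lemma moment_matrix_L_eq_block_moment:
  "moment_matrix_L q p \<mu> k i j = block_moment q p \<mu> i (j + k)"
  by (simp add: moment_matrix_L_def moment_matrix_eq_monomial_vec block_moment_def
      transpose_christoffel_pow_mult_monomial_vec)

lemma moment_matrix_R_eq_block_moment:
  "moment_matrix_R q p \<mu> k i j = block_moment q p \<mu> (i + k) j"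
  by (simp add: moment_matrix_R_def moment_matrix_eq_monomial_vec block_moment_def
      transpose_christoffel_pow_mult_monomial_vec)

lemma block_moment_add_period:
  "block_moment q p \<mu> (i + q) j = block_moment q p \<mu> i (j + p)"
proof -
  have "monomial_vec q x (i + q) $ b * monomial_vec p x j $ a =
      monomial_vec q x i $ b * monomial_vec p x (j + p) $ a" if "b < q" "a < p" for a b x
    using that
    by (simp add: monomial_vec_add_period carrier_vecD [OF monomial_vec_carrier])
  then show ?thesis
    unfolding block_moment_def by (intro sum.cong refl) simp
qed

lemma moment_matrix_L_Suc:
  "moment_matrix_L q p \<mu> (Suc k) = moment_matrix_L q p \<mu> k \<star> stranspose \<Lambda>"
  by (intro ext) (simp add: smult_mat_stranspose_shift moment_matrix_L_eq_block_moment)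

lemma moment_matrix_R_Suc:
  "moment_matrix_R q p \<mu> (Suc k) = \<Lambda> \<star> moment_matrix_R q p \<mu> k"
  by (intro ext) (simp add: shift_smult_mat moment_matrix_R_eq_block_moment)

lemma moment_matrix_L_0_eq_R_0: "moment_matrix_L q p \<mu> 0 = moment_matrix_R q p \<mu> 0"
  by (intro ext) (simp add: moment_matrix_L_eq_block_moment moment_matrix_R_eq_block_moment)

lemma moment_matrix_L_eq_R: "moment_matrix_L q p \<mu> p = moment_matrix_R q p \<mu> q"
  by (intro ext)
    (simp add: moment_matrix_L_eq_block_moment moment_matrix_R_eq_block_moment
      block_moment_add_period)

theorem theorem4p2:
  fixes p q :: nat
    and \<Delta> :: "real set"
    and \<mu> :: "nat \<Rightarrow> nat \<Rightarrow> real_measure"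
    and LL UL LR UR :: "nat \<Rightarrow> smat"
  assumes "p \<ge> 1" and "q \<ge> 1"
    and "is_interval \<Delta>"
    and "matrix_of_measures q p \<Delta> \<mu>"
    and "\<And>k. k \<le> p \<Longrightarrow> gauss_borel (moment_matrix_L q p \<mu> k) (LL k) (UL k)"
    and "\<And>k. k \<le> q \<Longrightarrow> gauss_borel (moment_matrix_R q p \<mu> k) (LR k) (UR k)"
  shows "(\<forall>k\<in>{1..p}. \<exists>!L. is_lower_factor UL k L) \<and>
         (\<forall>k\<in>{1..q}. \<exists>!U. is_upper_factor LR k U) \<and>
         recurrence_matrix q (LL 0) =
           sprod (map (lower_factor UL) [1..<Suc p] @ map (upper_factor LR) (rev [1..<Suc q]))"
proof -
  let ?Ls = "map (lower_factor UL) [1..<Suc p]" and ?Us = "map (upper_factor LR) (rev [1..<Suc q])"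
  note lower = lower_factor_chain [of p "moment_matrix_L q p \<mu>", OF assms(5) moment_matrix_L_Suc]
    and upper = upper_factor_chain [of q "moment_matrix_R q p \<mu>", OF assms(6) moment_matrix_R_Suc]
  have first_factors: "LR 0 = LL 0" and last_factors: "LR q = LL p"
    using assms(5) [of 0] assms(6) [of 0] assms(5) [of p] assms(6) [of q]
    by (auto simp: moment_matrix_L_0_eq_R_0 moment_matrix_L_eq_R intro: gauss_borel_lower_unique)
  have lower_unitriangular_LL: "lower_unitriangular (LL k)" if "k \<le> p" for k
    using assms(5) [OF that] by (rule gauss_borelD)
  have row_finite: "row_finite (sprod ?Ls)" "row_finite (sprod ?Us)"
    "row_finite (sprod (?Ls @ ?Us))" "row_finite (LL p)" "row_finite (LL 0 \<star> spow \<Lambda> q)"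
    using lower(2) upper(2) lower_unitriangular_LL row_finite_lower_unitriangular
    by (auto intro!: row_finite_sprod row_finite_smult_mat row_finite_spow row_finite_shift
        simp del: upt_Suc)
  have "sprod (?Ls @ ?Us) \<star> LL 0 = sprod ?Ls \<star> (sprod ?Us \<star> LR 0)"
    by (simp only: sprod_append [OF lower(2)] smult_mat_assoc_row_row row_finite first_factors)
  also have "\<dots> = sprod ?Ls \<star> LL p \<star> spow \<Lambda> q"
    by (simp only: upper(3) last_factors smult_mat_assoc_row_row row_finite)
  also have "\<dots> = LL 0 \<star> spow \<Lambda> q"
    by (simp only: lower(3))
  finally have "sprod (?Ls @ ?Us) = recurrence_matrix q (LL 0)"
    unfolding recurrence_matrix_def
    using eq_smult_sinverse_lower_iff lower_unitriangular_LL row_finite by blast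
  then show ?thesis
    using lower(1) upper(1) by simp
qed

end
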